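(* Let $I\subseteq\mathbb{K}\langle X\rangle$ be a two-sided ideal and let $T$ be the reduction operator on $\mathbb{K}\langle X\rangle$ with kernel $I$. Then the algebra $\mathbb{K}\langle X\rangle/I$ is syntactic if and only if there exists $S'\in\widehat{\mathbb{K}\,\mathrm{nf}(T)}$ such that $I$ is the greatest two-sided ideal of $\mathbb{K}\langle X\rangle$ included in $I\oplus\ker(S')$.
   Context: Let $\mathbb{K}$ be a commutative field, $X=\{x_1,\dots,x_n\}$ a finite set, $X^*$ the set of words over $X$ (noncommutative monomials), $\mathbb{K}\langle X\rangle$ the noncommutative polynomial algebra over $X$ and $\mathbb{K}\langle\langle X\rangle\rangle$ the algebra of noncommutative formal power series. Fix a monomial order $<$ on $X^*$, i.e. a well-order compatible with multiplication. A series $S=\sum_w S_w w$ is identified with the linear form on $\mathbb{K}\langle X\rangle$ mapping each word $w$ to $S_w$, and $\ker(S)\subseteq\mathbb{K}\langle X\rangle$ is the kernel of this form. Syntactic algebras. The syntactic ideal $I_S$ of $S\in\mathbb{K}\langle\langle X\rangle\rangle$ is the greatest two-sided ideal of $\mathbb{K}\langle X\rangle$ included in $\ker(S)$; the syntactic algebra of $S$ is $\mathbb{K}\langle X\rangle/I_S$. The algebra $\mathbb{K}\langle X\rangle/I$ is said to be syntactic if it is the syntactic algebra of a formal power series, i.e. $I=I_S$ for some $S\in\mathbb{K}\langle\langle X\rangle\rangle$. Reduction operators. A reduction operator on $\mathbb{K}\langle X\rangle$ is a linear projector $T$ of $\mathbb{K}\langle X\rangle$ such that for every word $w$, $T(w)\neq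 w$ implies that every word in the support of $T(w)$ is strictly smaller than $w$ for $<$. For every subspace $V$ of $\mathbb{K}\langle X\rangle$ there is exactly one reduction operator with kernel $V$. Put $\mathrm{nf}(T)=\{w\in X^*\mid T(w)=w\}$, let $\mathbb{K}\,\mathrm{nf}(T)$ be its linear span, and let $\widehat{\mathbb{K}\,\mathrm{nf}(T)}$ be the set of formal power series whose nonzero coefficients only involve words of $\mathrm{nf}(T)$. For $S'\in\widehat{\mathbb{K}\,\mathrm{nf}(T)}$, viewed as a linear form on $\mathbb{K}\,\mathrm{nf}(T)$, $\ker(S')\subseteq\mathbb{K}\,\mathrm{nf}(T)$ denotes its kernel there. The sum $I+V$ is direct for every subspace $V\subseteq\mathbb{K}\,\mathrm{nf}(T)$ when $I=\ker(T)$. *)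

theory Defs
  imports "HOL-Library.Poly_Mapping" "HOL-Algebra.Algebraic_Closure_Type"
begin

text \<open>
  Words over the alphabet \<open>'x\<close> are lists. With concatenation as (additively written,
  non-commutative) monoid operation on them, the convolution product of
  \<^theory>\<open>HOL-Library.Poly_Mapping\<close> makes \<open>'x list \<Rightarrow>\<^sub>0 'k\<close> the monoid algebra of the free
  monoid over \<open>'x\<close>, that is, the algebra of noncommutative polynomials.
\<close>

instantiation list :: (type) monoid_add
begin

definition zero_list :: "'a list" where "zero_list = []"

definition plus_list :: "'a list \<Rightarrow> 'a list \<Rightarrow> 'a list" where "plus_list u v = u @ v"

instance by standard (simp_all add: zero_list_def plus_list_def)

end

type_synonym ('x, 'k) ncpoly = "'x list \<Rightarrow>\<^sub>0 'k"

type_synonym ('x, 'k) ncseries = "'x list \<Rightarrow> 'k"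

abbreviation word :: "'x list \<Rightarrow> ('x, 'k::field) ncpoly" where
  "word w \<equiv> Poly_Mapping.single w 1"

lemma word_mult: "(word u :: ('x, 'k::field) ncpoly) * word v = word (u @ v)"
  by (simp add: Poly_Mapping.mult_single plus_list_def)

definition scale :: "'k::field \<Rightarrow> ('x, 'k) ncpoly \<Rightarrow> ('x, 'k) ncpoly" where
  "scale c f = Poly_Mapping.map ((*) c) f"

lemma lookup_scale [simp]: "Poly_Mapping.lookup (scale c f) w = c * Poly_Mapping.lookup f w"
  by (simp add: scale_def Poly_Mapping.map.rep_eq when_def)

global_interpretation ncpoly: vector_space scale
  by standard (simp_all add: poly_mapping_eq_iff fun_eq_iff lookup_add algebra_simps)

lemma scale_eq_mult:
  fixes f :: "('a, 'b::field) ncpoly"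
  shows "scale c f = Poly_Mapping.single [] c * f"
    and "scale c f = f * Poly_Mapping.single [] c"
proof -
  have mono: "scale c (Poly_Mapping.single k v) = Poly_Mapping.single k (c * v)"
    for k :: "'a list" and v
    by (rule poly_mapping_eqI) (simp add: lookup_single when_def)
  have "scale c g = Poly_Mapping.single [] c * g \<and> scale c g = g * Poly_Mapping.single [] c"
    for g :: "('a, 'b) ncpoly"
  proof (induction g rule: update_induct)
    case const
    then show ?case by simp
  next
    case (update g a b)
    then have eq: "Poly_Mapping.update a b g = g + Poly_Mapping.single a b"
      by (intro poly_mapping_eqI)
        (auto simp: lookup_update lookup_add lookup_single when_def in_keys_iff)
    show ?case
      unfolding eq ncpoly.scale_right_distrib mono distrib_left distrib_right
        Poly_Mapping.mult_single plus_list_def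
      using update(3) by (metis mult.commute append_Nil append_Nil2)
  qed
  then show "scale c f = Poly_Mapping.single [] c * f" "scale c f = f * Poly_Mapping.single [] c"
    by blast+
qed


text \<open>In HOL-Algebra, \<^const>\<open>ideal\<close> means two-sided ideal.\<close>

abbreviation two_sided_ideal :: "'a::ring_1 set \<Rightarrow> bool" where
  "two_sided_ideal I \<equiv> ideal I ring_of_type_algebra"

lemma ring_ring_of_type_algebra: "ring (ring_of_type_algebra :: 'a::ring_1 ring)"
proof -
  have "\<exists>y. x + y = 0" for x :: 'a
    using add.right_inverse by blast
  then show ?thesis
    unfolding ring_of_type_algebra_def using add.right_inverse
    by unfold_locales (auto simp: algebra_simps Units_def)
qed

lemma two_sided_ideal_iff:
  fixes I :: "'a::ring_1 set"
  shows "two_sided_ideal I \<longleftrightarrow>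
     0 \<in> I \<and> (\<forall>a\<in>I. \<forall>b\<in>I. a + b \<in> I) \<and> (\<forall>a\<in>I. \<forall>p. p * a \<in> I \<and> a * p \<in> I)"
  (is "?L \<longleftrightarrow> ?R")
proof
  assume ?L
  then interpret ideal I "ring_of_type_algebra :: 'a ring" .
  show ?R
    using additive_subgroup.a_closed[OF is_additive_subgroup] I_l_closed I_r_closed
      additive_subgroup.zero_closed[OF is_additive_subgroup]
    by (auto simp: ring_of_type_algebra_def)
next
  assume R: ?R
  let ?R = "ring_of_type_algebra :: 'a ring"
  interpret ring ?R by (rule ring_ring_of_type_algebra)
  have neg: "\<ominus>\<^bsub>?R\<^esub> a = - a" for a
    by (rule minus_equality) (simp_all add: ring_of_type_algebra_def)
  have "- a \<in> I" if "a \<in> I" for a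
    using R that by (metis mult_minus1)
  then have "subgroup I (add_monoid ?R)"
    using R neg by unfold_locales (auto simp: ring_of_type_algebra_def a_inv_def)
  show ?L
  proof (rule idealI)
    show "ring ?R" by (rule ring_ring_of_type_algebra)
    show "subgroup I (add_monoid ?R)" by fact
  qed (use R in \<open>auto simp: ring_of_type_algebra_def\<close>)
qed

definition greatest_ideal_in :: "'a::ring_1 set \<Rightarrow> 'a set \<Rightarrow> bool" where
  "greatest_ideal_in I V \<longleftrightarrow>
     two_sided_ideal I \<and> I \<subseteq> V \<and> (\<forall>J. two_sided_ideal J \<and> J \<subseteq> V \<longrightarrow> J \<subseteq> I)"


definition series_form :: "('x, 'k::field) ncseries \<Rightarrow> ('x, 'k) ncpoly \<Rightarrow> 'k" where
  "series_form S f = (\<Sum>w\<in>Poly_Mapping.keys f. S w * Poly_Mapping.lookup f w)"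

definition series_ker :: "('x, 'k::field) ncseries \<Rightarrow> ('x, 'k) ncpoly set" where
  "series_ker S = {f. series_form S f = 0}"

definition syntactic_ideal :: "('x, 'k::field) ncseries \<Rightarrow> ('x, 'k) ncpoly set" where
  "syntactic_ideal S = (THE I. greatest_ideal_in I (series_ker S))"

text \<open>The quotient algebra by \<open>I\<close> is syntactic.\<close>

definition quotient_syntactic :: "('x, 'k::field) ncpoly set \<Rightarrow> bool" where
  "quotient_syntactic I \<longleftrightarrow> (\<exists>S. I = syntactic_ideal S)"

lemma series_form_superset:
  assumes "finite A" "Poly_Mapping.keys f \<subseteq> A"
  shows "series_form S f = (\<Sum>w\<in>A. S w * Poly_Mapping.lookup f w)"
  unfolding series_form_def
  by (rule sum.mono_neutral_left) (use assms in \<open>auto simp: in_keys_iff\<close>)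

lemma series_form_add: "series_form S (f + g) = series_form S f + series_form S g"
proof -
  have "finite (Poly_Mapping.keys f \<union> Poly_Mapping.keys g)"
    "Poly_Mapping.keys (f + g) \<subseteq> Poly_Mapping.keys f \<union> Poly_Mapping.keys g"
    by (simp_all add: Poly_Mapping.keys_add)
  then show ?thesis
    by (simp add: series_form_superset[of "Poly_Mapping.keys f \<union> Poly_Mapping.keys g"] lookup_add
        algebra_simps sum.distrib)
qed

lemma series_form_word: "series_form S (word w) = S w"
  by (simp add: series_form_def)

lemma greatest_ideal_in_syntactic_ideal: "greatest_ideal_in (syntactic_ideal S) (series_ker S)"
proof -
  define J where "J = {f. \<forall>p q. p * f * q \<in> series_ker S}"
  have "two_sided_ideal J"
    unfolding two_sided_ideal_iff
  proof (intro conjI ballI allI)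
    show "0 \<in> J"
      by (simp add: J_def series_ker_def series_form_def)
    show "a + b \<in> J" if "a \<in> J" "b \<in> J" for a b
      using that by (simp add: J_def series_ker_def distrib_left distrib_right series_form_add)
    show "p * a \<in> J" "a * p \<in> J" if "a \<in> J" for a p
      using that by (auto simp: J_def) (metis mult.assoc)+
  qed
  moreover have "J \<subseteq> series_ker S"
  proof
    fix f assume "f \<in> J"
    then have "1 * f * 1 \<in> series_ker S" unfolding J_def by blast
    then show "f \<in> series_ker S" by simp
  qed
  moreover have "I \<subseteq> J" if "two_sided_ideal I" "I \<subseteq> series_ker S" for I
    using that unfolding two_sided_ideal_iff J_def by blast
  ultimately have "greatest_ideal_in J (series_ker S)"
    by (simp add: greatest_ideal_in_def)
  then show ?thesis
    unfolding syntactic_ideal_def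
    by (rule theI) (use \<open>greatest_ideal_in J (series_ker S)\<close> in
        \<open>auto simp: greatest_ideal_in_def\<close>)
qed


text \<open>\<open>r\<close> is the reflexive version of the order; the strict order is \<open>r - Id\<close>.\<close>

definition monomial_order :: "'x list rel \<Rightarrow> bool" where
  "monomial_order r \<longleftrightarrow> well_order_on UNIV r \<and>
     (\<forall>u v a b. (u, v) \<in> r - Id \<longrightarrow> (a @ u @ b, a @ v @ b) \<in> r - Id)"

definition reduction_operator ::
    "'x list rel \<Rightarrow> (('x, 'k::field) ncpoly \<Rightarrow> ('x, 'k) ncpoly) \<Rightarrow> bool" where
  "reduction_operator r T \<longleftrightarrow> Vector_Spaces.linear scale scale T \<and> T \<circ> T = T \<and>
     (\<forall>w. T (word w) \<noteq> word w \<longrightarrow> (\<forall>v\<in>Poly_Mapping.keys (T (word w)). (v, w) \<in> r - Id))"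

definition nf :: "(('x, 'k::field) ncpoly \<Rightarrow> ('x, 'k) ncpoly) \<Rightarrow> 'x list set" where
  "nf T = {w. T (word w) = word w}"

definition nf_span :: "(('x, 'k::field) ncpoly \<Rightarrow> ('x, 'k) ncpoly) \<Rightarrow> ('x, 'k) ncpoly set" where
  "nf_span T = ncpoly.span (word ` nf T)"

definition nf_series :: "(('x, 'k::field) ncpoly \<Rightarrow> ('x, 'k) ncpoly) \<Rightarrow> ('x, 'k) ncseries set" where
  "nf_series T = {S. \<forall>w. S w \<noteq> 0 \<longrightarrow> w \<in> nf T}"

definition nf_ker ::
    "(('x, 'k::field) ncpoly \<Rightarrow> ('x, 'k) ncpoly) \<Rightarrow> ('x, 'k) ncseries \<Rightarrow> ('x, 'k) ncpoly set" where
  "nf_ker T S = {f \<in> nf_span T. series_form S f = 0}"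

definition sum_space :: "'a::plus set \<Rightarrow> 'a set \<Rightarrow> 'a set" where
  "sum_space U V = {u + v |u v. u \<in> U \<and> v \<in> V}"

text \<open>The sum of the kernel of a reduction operator and a subspace of \<^term>\<open>nf_span T\<close> is
  automatically direct:\<close>

lemma kernel_inter_nf_span:
  fixes T :: "('x, 'k::field) ncpoly \<Rightarrow> ('x, 'k) ncpoly"
  assumes "reduction_operator r T"
  shows "{f. T f = 0} \<inter> nf_span T = {0}"
proof -
  interpret T: Vector_Spaces.linear scale scale T
    using assms by (simp add: reduction_operator_def)
  have "T f = f" if "f \<in> nf_span T" for f
    using that unfolding nf_span_def
    by (induction rule: ncpoly.span_induct_alt) (auto simp: nf_def T.zero T.add T.scale)
  moreover have "0 \<in> nf_span T"
    by (simp add: nf_span_def ncpoly.span_zero)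
  ultimately show ?thesis
    by (auto simp: T.zero)
qed

end

theory Submission
  imports Defs
begin

text \<open>
  The reduction operator \<open>T\<close> is a projector with kernel \<open>I\<close> onto the span of its normal forms, so
  polynomials split as \<open>f = (f - T f) + T f\<close> with \<open>f - T f \<in> I\<close> and \<open>T f\<close> a combination of normal
  forms. A linear form \<open>S\<close> whose kernel contains \<open>I\<close> therefore carries the same information as a
  linear form \<open>S'\<close> on the span of the normal forms: \<open>S'\<close> is the restriction of \<open>S\<close>, and \<open>S\<close> is
  recovered as \<open>S' \<circ> T\<close>. For such a pair, \<open>I + ker S'\<close> is exactly \<open>ker S\<close>
  (\<open>sum_space_nf_ker\<close>), so \<open>I\<close> is the greatest ideal inside the former if and only if it is the
  greatest ideal inside the latter, that is, the syntactic ideal of \<open>S\<close>.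

  The point that depends on the order is that the image of \<open>T\<close> is spanned by normal forms
  (\<open>reduction_operator_in_nf_span\<close>).
\<close>

lemma ncpoly_sum_words:
  fixes f :: "('x, 'k::field) ncpoly"
  shows "f = (\<Sum>w\<in>Poly_Mapping.keys f. scale (Poly_Mapping.lookup f w) (word w))"
proof (rule poly_mapping_eqI)
  fix v
  have "(\<Sum>w\<in>Poly_Mapping.keys f. Poly_Mapping.lookup (scale (Poly_Mapping.lookup f w) (word w)) v)
    = (\<Sum>w\<in>Poly_Mapping.keys f. if w = v then Poly_Mapping.lookup f w else 0)"
    by (rule sum.cong) (auto simp: lookup_single when_def)
  then show "Poly_Mapping.lookup f v =
      Poly_Mapping.lookup (\<Sum>w\<in>Poly_Mapping.keys f. scale (Poly_Mapping.lookup f w) (word w)) v"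
    by (simp add: lookup_sum in_keys_iff)
qed

lemma linear_sum_words:
  fixes f :: "('x, 'k::field) ncpoly"
  assumes "Vector_Spaces.linear scale s T"
  shows "T f = (\<Sum>w\<in>Poly_Mapping.keys f. s (Poly_Mapping.lookup f w) (T (word w)))"
proof -
  interpret T: Vector_Spaces.linear scale s T by fact
  show ?thesis
    by (subst ncpoly_sum_words[of f]) (simp only: T.sum T.scale)
qed

lemma span_words_iff:
  fixes f :: "('x, 'k::field) ncpoly"
  shows "f \<in> ncpoly.span (word ` A) \<longleftrightarrow> Poly_Mapping.keys f \<subseteq> A"
proof
  assume "f \<in> ncpoly.span (word ` A)"
  then have "\<forall>w. w \<notin> A \<longrightarrow> Poly_Mapping.lookup f w = 0"
    by (induction rule: ncpoly.span_induct_alt)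
      (auto simp: lookup_add lookup_single when_def split: if_splits)
  then show "Poly_Mapping.keys f \<subseteq> A"
    by (auto simp: in_keys_iff)
next
  assume "Poly_Mapping.keys f \<subseteq> A"
  then have "(\<Sum>w\<in>Poly_Mapping.keys f. scale (Poly_Mapping.lookup f w) (word w))
      \<in> ncpoly.span (word ` A)"
    by (intro ncpoly.span_sum ncpoly.span_scale ncpoly.span_base) auto
  then show "f \<in> ncpoly.span (word ` A)"
    by (simp only: ncpoly_sum_words[symmetric])
qed

lemma linear_series_form:
  "Vector_Spaces.linear scale (*) (series_form (S :: ('x, 'k::field) ncseries))"
proof unfold_locales
  fix c and f :: "('x, 'k) ncpoly"
  have "Poly_Mapping.keys (scale c f) \<subseteq> Poly_Mapping.keys f"
    by (auto simp: in_keys_iff)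
  from series_form_superset[OF finite_keys this, of S]
  show "series_form S (scale c f) = c * series_form S f"
    by (simp add: series_form_def sum_distrib_left algebra_simps)
qed (simp_all add: series_form_add distrib_left distrib_right mult.assoc)

lemma reduction_operator_idem:
  assumes "reduction_operator r T"
  shows "T (T f) = T f"
proof -
  have "T \<circ> T = T"
    using assms unfolding reduction_operator_def by blast
  from fun_cong[OF this, of f] show ?thesis
    by (simp only: comp_apply)
qed

text \<open>
  Consider a maximal word \<open>w\<close> of \<open>T f\<close> that is not a normal form. Since \<open>T\<close> fixes \<open>T f\<close>, the
  coefficient of \<open>w\<close> in \<open>T f\<close> is contributed by the images of the words of \<open>T f\<close>. But a normal form is
  its own image and differs from \<open>w\<close>, while the other words are sent to strictly smaller ones, none
  of which can be \<open>w\<close>. So the coefficient vanishes, a contradiction.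
\<close>
lemma reduction_operator_in_nf_span:
  fixes T :: "('x, 'k::field) ncpoly \<Rightarrow> ('x, 'k) ncpoly"
  assumes "partial_order_on UNIV r" and T: "reduction_operator r T"
  shows "T f \<in> nf_span T"
proof -
  define g where "g = T f"
  have lin: "Vector_Spaces.linear scale scale T"
    using T by (simp add: reduction_operator_def)
  have Tg: "T g = g"
    unfolding g_def by (simp only: reduction_operator_idem[OF T])
  define B where "B = Poly_Mapping.keys g - nf T"
  have "B = {}"
  proof (rule ccontr)
    assume "B \<noteq> {}"
    have "finite B"
      by (simp add: B_def)
    have "asymp_on B (\<lambda>u v. (u, v) \<in> r - Id)" "transp_on B (\<lambda>u v. (u, v) \<in> r - Id)"
      using assms(1) unfolding partial_order_on_def preorder_on_def
      by (auto simp: transp_on_def asymp_on_def trans_def antisym_def; blast)+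
    from Finite_Set.bex_max_element[OF \<open>finite B\<close> this \<open>B \<noteq> {}\<close>]
    obtain w where w: "w \<in> B" and max: "\<forall>v\<in>B. v \<noteq> w \<longrightarrow> (w, v) \<notin> r - Id"
      by blast
    have "Poly_Mapping.lookup (T (word v)) w = 0" if "v \<in> Poly_Mapping.keys g" for v
    proof (cases "v \<in> nf T")
      case True
      then show ?thesis
        using w by (auto simp: nf_def B_def lookup_single when_def)
    next
      case False
      with that have "v \<in> B"
        by (simp add: B_def)
      have smaller: "\<forall>u\<in>Poly_Mapping.keys (T (word v)). (u, v) \<in> r - Id"
        using False T by (simp add: reduction_operator_def nf_def)
      have "w \<notin> Poly_Mapping.keys (T (word v))"
      proof
        assume "w \<in> Poly_Mapping.keys (T (word v))"
        with smaller have "(w, v) \<in> r - Id" ..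
        with max \<open>v \<in> B\<close> show False by auto
      qed
      then show ?thesis by (simp add: in_keys_iff)
    qed
    then have "Poly_Mapping.lookup (T g) w = 0"
      unfolding linear_sum_words[OF lin, of g] by (simp add: lookup_sum)
    with w Tg show False
      by (simp add: B_def in_keys_iff)
  qed
  then show ?thesis
    by (auto simp: nf_span_def span_words_iff B_def g_def)
qed

text \<open>
  The hypothesis says that \<open>S = S' \<circ> T\<close> as linear forms. Modulo \<open>ker T\<close> every \<open>f\<close> equals \<open>T f\<close>,
  which is a combination of normal forms, and \<open>S\<close> vanishes on \<open>f\<close> exactly when \<open>S'\<close> vanishes on this
  representative.
\<close>
lemma sum_space_nf_ker:
  fixes T :: "('x, 'k::field) ncpoly \<Rightarrow> ('x, 'k) ncpoly"
  assumes "partial_order_on UNIV r" and T: "reduction_operator r T"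
    and factor: "\<And>f. series_form S f = series_form S' (T f)"
  shows "sum_space {f. T f = 0} (nf_ker T S') = series_ker S"
proof -
  interpret T: Vector_Spaces.linear scale scale T
    using T by (simp add: reduction_operator_def)
  have idem: "T (T f) = T f" for f
    by (rule reduction_operator_idem[OF T])
  have fixes_nf: "T v = v" if "v \<in> nf_span T" for v
  proof -
    have "T (v - T v) = 0"
      by (simp add: T.diff idem)
    moreover have "v - T v \<in> nf_span T"
      using that reduction_operator_in_nf_span[OF assms(1,2), of v]
      unfolding nf_span_def by (rule ncpoly.span_diff)
    ultimately have "v - T v \<in> {0}"
      unfolding kernel_inter_nf_span[OF T, symmetric] by simp
    then show ?thesis by simp
  qed
  show ?thesis
  proof (intro equalityI subsetI)
    fix f assume "f \<in> sum_space {f. T f = 0} (nf_ker T S')"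
    then obtain u v where f: "f = u + v" "T u = 0" "v \<in> nf_span T" "series_form S' v = 0"
      by (auto simp: sum_space_def nf_ker_def)
    then have "T f = v"
      by (simp add: T.add fixes_nf)
    with f show "f \<in> series_ker S"
      by (simp add: series_ker_def factor)
  next
    fix f assume "f \<in> series_ker S"
    then have "T f \<in> nf_ker T S'"
      using reduction_operator_in_nf_span[OF assms(1,2)]
      by (simp add: nf_ker_def series_ker_def factor)
    moreover have "T (f - T f) = 0"
      by (simp add: T.diff idem)
    moreover have "f = (f - T f) + T f"
      by simp
    ultimately show "f \<in> sum_space {f. T f = 0} (nf_ker T S')"
      unfolding sum_space_def by blast
  qed
qed

lemma eq_syntactic_ideal_iff:
  "I = syntactic_ideal S \<longleftrightarrow> greatest_ideal_in I (series_ker S)"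
  using greatest_ideal_in_syntactic_ideal[of S] unfolding greatest_ideal_in_def by blast

theorem theorem4p2p2:
  fixes r :: "'x::finite list rel"
    and I :: "('x, 'k::field) ncpoly set"
    and T :: "('x, 'k) ncpoly \<Rightarrow> ('x, 'k) ncpoly"
  assumes "monomial_order r"
    and "two_sided_ideal I"
    and "reduction_operator r T"
    and "{f. T f = 0} = I"
  shows "quotient_syntactic I \<longleftrightarrow>
    (\<exists>S'\<in>nf_series T. greatest_ideal_in I (sum_space I (nf_ker T S')))"
proof -
  have po: "partial_order_on UNIV r"
    using assms(1) by (simp add: monomial_order_def well_order_on_def linear_order_on_def)
  note nf_span = reduction_operator_in_nf_span[OF po assms(3)]
  have linT: "Vector_Spaces.linear scale scale T"
    using assms(3) by (simp add: reduction_operator_def)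
  interpret T: Vector_Spaces.linear scale scale T by fact
  have idem: "T (T f) = T f" for f
    by (rule reduction_operator_idem[OF assms(3)])
  have ker_sum: "sum_space I (nf_ker T S') = series_ker S"
    if "\<And>f. series_form S f = series_form S' (T f)" for S S'
    using sum_space_nf_ker[OF po assms(3), of S S'] that assms(4) by simp
  show ?thesis
  proof
    assume "quotient_syntactic I"
    then obtain S where S: "greatest_ideal_in I (series_ker S)"
      by (auto simp: quotient_syntactic_def eq_syntactic_ideal_iff)
    interpret S: Vector_Spaces.linear scale "(*)" "series_form S"
      by (rule linear_series_form)
    define S' where "S' = (\<lambda>w. if w \<in> nf T then S w else 0)"
    have "series_form S f = series_form S' (T f)" for f
    proof -
      have "f - T f \<in> I"
        unfolding assms(4)[symmetric] by (simp add: T.diff idem)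
      then have "series_form S (f - T f) = 0"
        using S by (auto simp: greatest_ideal_in_def series_ker_def)
      then have "series_form S f = series_form S (T f)"
        by (simp add: S.diff)
      also have "\<dots> = series_form S' (T f)"
        using nf_span[of f] unfolding series_form_def nf_span_def span_words_iff S'_def
        by (intro sum.cong) auto
      finally show ?thesis .
    qed
    from ker_sum[OF this] S
    have "greatest_ideal_in I (sum_space I (nf_ker T S'))" by simp
    moreover have "S' \<in> nf_series T"
      by (simp add: nf_series_def S'_def)
    ultimately show "\<exists>S'\<in>nf_series T. greatest_ideal_in I (sum_space I (nf_ker T S'))"
      by blast
  next
    assume "\<exists>S'\<in>nf_series T. greatest_ideal_in I (sum_space I (nf_ker T S'))"
    then obtain S' where S': "greatest_ideal_in I (sum_space I (nf_ker T S'))"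
      by blast
    interpret S': Vector_Spaces.linear scale "(*)" "series_form S'"
      by (rule linear_series_form)
    define S where "S = (\<lambda>w. series_form S' (T (word w)))"
    have "series_form S f = series_form S' (T f)" for f
      unfolding linear_sum_words[OF linT, of f] series_form_def[of S]
      by (simp add: S_def S'.sum S'.scale mult.commute)
    from ker_sum[OF this] S' have "I = syntactic_ideal S"
      by (simp add: eq_syntactic_ideal_iff)
    then show "quotient_syntactic I"
      by (auto simp: quotient_syntactic_def)
  qed
qed

end
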